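(* For every odd dimension $n\ge 5$ there exist irregular $n$-simplices whose largest hyperplane section is not one of their faces; that is, there exists a (non-degenerate, non-regular) $n$-simplex $T$ and a hyperplane $H$ of the $n$-dimensional affine space spanned by $T$ such that $\operatorname{vol}_{n-1}(H\cap T)>\operatorname{vol}_{n-1}(G)$ for every $(n-1)$-dimensional face $G$ of $T$.
   Context: An $n$-simplex is the convex hull of $n+1$ affinely independent points; its faces here are its $(n-1)$-dimensional faces (facets), i.e. the convex hulls of $n$ of its vertices. It is irregular if its edges do not all have the same length. $\operatorname{vol}_{n-1}$ is $(n-1)$-dimensional Lebesgue volume in the affine subspace containing the set. *)

theory Defs
  imports "HOL-Analysis.Analysis"
begin

text \<open>
  The \<open>k\<close>-dimensional Lebesgue volume of a set lying in a \<open>k\<close>-dimensional affine subspace is its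
  Lebesgue measure in Cartesian coordinates on that subspace. As \<open>k\<close> is a number and not a type,
  the coordinate space is the product space of functions on \<open>{..<k}\<close>.
\<close>

definition orthonormal_frame :: "nat \<Rightarrow> (nat \<Rightarrow> 'a::euclidean_space) \<Rightarrow> bool" where
  "orthonormal_frame k e \<longleftrightarrow> (\<forall>i<k. \<forall>j<k. e i \<bullet> e j = (if i = j then 1 else 0))"

definition frame_map :: "nat \<Rightarrow> 'a::euclidean_space \<Rightarrow> (nat \<Rightarrow> 'a) \<Rightarrow> (nat \<Rightarrow> real) \<Rightarrow> 'a" where
  "frame_map k p e x = p + (\<Sum>i<k. x i *\<^sub>R e i)"

text \<open>
  The value does not depend on the chosen origin \<open>p\<close> and frame \<open>e\<close>, Lebesgue measure being
  invariant under isometries; a set contained in an affine subspace of dimension less than \<open>k\<close>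
  gets volume 0. It is meaningful only for sets contained in some \<open>k\<close>-dimensional affine subspace.
\<close>

definition vol :: "nat \<Rightarrow> 'a::euclidean_space set \<Rightarrow> real" where
  "vol k S =
    (let (p, e) = (SOME (p, e). orthonormal_frame k e \<and> S \<subseteq> range (frame_map k p e))
     in measure (completion (Pi\<^sub>M {..<k} (\<lambda>_. lborel)))
          {x \<in> {..<k} \<rightarrow>\<^sub>E UNIV. frame_map k p e x \<in> S})"

definition irregular :: "'a::euclidean_space set \<Rightarrow> bool" where
  "irregular T \<longleftrightarrow>
    (\<exists>a b c d. closed_segment a b edge_of T \<and> closed_segment c d edge_of T \<and> dist a b \<noteq> dist c d)"

end

theory Submission
  imports Defs
begin

text \<open>
  Walkup's idea: write \<open>n = 2d + 1\<close> and let \<open>T\<close> be the join of two \<open>d\<close>-simplices \<open>A\<close> and \<open>B\<close> that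
  lie in orthogonal \<open>d\<close>-dimensional directions, have their centroids at the two ends of a unit
  segment orthogonal to both, and are scaled by a large factor \<open>R\<close>. The middle section of \<open>T\<close>, half
  way between \<open>A\<close> and \<open>B\<close>, is a product of half-size copies of \<open>A\<close> and \<open>B\<close>, and for large \<open>R\<close> it is
  larger than every facet.

  No volume of \<open>A\<close>, \<open>B\<close> or \<open>T\<close> is ever computed. Both the middle section and each facet are compared with
  the \<open>n\<close>-dimensional volume of \<open>T\<close> by slicing \<open>T\<close> with parallel hyperplanes
  (\<open>emeasure_scaled_slices\<close>):

  \<^item> parallel to a facet \<open>G\<close>, the slices are homothetic copies of \<open>G\<close>, so \<open>vol T = h * vol G / n\<close>, where
    \<open>h\<close> is the height of \<open>T\<close> over \<open>G\<close>; this height is \<open>1 / norm g\<close> for the gradient \<open>g\<close> of the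
    barycentric coordinate that vanishes on \<open>G\<close> (\<open>measure_T_facet\<close>);
  \<^item> parallel to the middle section, the slice at height \<open>t\<close> arises from it by scaling \<open>d\<close> coordinates
    with \<open>2 (1 - t)\<close> and the other \<open>d\<close> with \<open>2 t\<close>, so \<open>vol T\<close> is the volume of the middle section times the
    Beta integral \<open>4 ^ d * (d!)\<^sup>2 / (2d + 1)!\<close> (\<open>measure_T_section\<close>).

  Hence the middle section beats \<open>G\<close> iff \<open>norm g < (2d)! / (4 ^ d * (d!)\<^sup>2)\<close>. Because the centroids lie on the
  common perpendicular, every barycentric coordinate changes along it, up to sign, at the rate
  \<open>1 / (d + 1)\<close>, and its other derivatives are of order \<open>1 / R\<close>; so every \<open>norm g\<close> tends to \<open>1 / (d + 1)\<close> as \<open>R\<close> grows, and it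
  remains to see that \<open>(d + 1) * (2d choose d) > 4 ^ d\<close>, which holds from \<open>d = 2\<close> on. This is where
  dimension 3, with equality for \<open>d = 1\<close>, drops out.

  What this takes from measure theory is that \<open>vol\<close>, defined by some coordinate frame of the affine
  subspace, does not depend on the frame (\<open>vol_eq_chart_volume\<close>); it comes down to the invariance of Lebesgue
  measure under orthogonal maps.
\<close>

section \<open>Lebesgue measure in orthonormal coordinates\<close>

interpretation lborel_product: product_sigma_finite "\<lambda>_::nat. lborel :: real measure" ..

text \<open>
  Uniqueness of Haar measure, in the form needed for orthogonal maps: the unit ball serves as the
  normalising set because they preserve it. The proof evaluates \<open>N A * lborel B\<close>, for \<open>B\<close> the unit ball, as a
  double integral, translates first the \<open>N\<close>-variable and then the \<open>lborel\<close>-variable so that \<open>A\<close> and \<open>B\<close> change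
  places, and arrives at \<open>lborel A * N B\<close>.
\<close>

lemma translation_invariant_eq_lborel:
  fixes N :: "'a::euclidean_space measure"
  assumes sets[measurable_cong, simp]: "sets N = sets borel" and sf: "sigma_finite_measure N"
    and inv: "\<And>c. distr N borel (\<lambda>x. c + x) = N"
    and ball: "emeasure N (ball 0 1) = emeasure lborel (ball (0::'a) 1)"
  shows "N = lborel"
proof (rule measure_eqI)
  show "sets N = sets lborel" by simp
next
  fix A assume "A \<in> sets N"
  then have A0[measurable]: "A \<in> sets borel" by simp
  interpret N: sigma_finite_measure N by fact
  interpret P: pair_sigma_finite N "lborel :: 'a measure"
    by (intro pair_sigma_finite.intro sf lborel.sigma_finite_measure_axioms)
  define B where "B = ball (0::'a) 1"
  have [measurable]: "B \<in> sets borel" by (simp add: B_def)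
  have "emeasure N A * emeasure lborel B = (\<integral>\<^sup>+y. \<integral>\<^sup>+x. indicator A x * indicator B y \<partial>N \<partial>lborel)"
    by (simp add: nn_integral_cmult nn_integral_multc nn_integral_cmult_indicator)
  also have "\<dots> = (\<integral>\<^sup>+y. \<integral>\<^sup>+x. indicator A (y + x) * indicator B y \<partial>N \<partial>lborel)"
  proof (rule nn_integral_cong)
    fix y :: 'a
    have "(\<integral>\<^sup>+x. indicator A x * indicator B y \<partial>N)
        = (\<integral>\<^sup>+x. indicator A x * indicator B y \<partial>(distr N borel (\<lambda>x. y + x)))"
      by (simp add: inv)
    also have "\<dots> = (\<integral>\<^sup>+x. indicator A (y + x) * indicator B y \<partial>N)"
      by (subst nn_integral_distr) auto
    finally show "(\<integral>\<^sup>+x. indicator A x * indicator B y \<partial>N)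
       = (\<integral>\<^sup>+x. indicator A (y + x) * indicator B y \<partial>N)" .
  qed
  also have "\<dots> = (\<integral>\<^sup>+x. \<integral>\<^sup>+y. indicator A (y + x) * indicator B y \<partial>lborel \<partial>N)"
    by (rule P.Fubini') measurable
  also have "\<dots> = (\<integral>\<^sup>+x. \<integral>\<^sup>+y. indicator A y * indicator B (y - x) \<partial>lborel \<partial>N)"
  proof (rule nn_integral_cong)
    fix x :: 'a
    have "(\<integral>\<^sup>+y. indicator A y * indicator B (y - x) \<partial>lborel)
        = (\<integral>\<^sup>+y. indicator A y * indicator B (y - x) \<partial>(distr lborel borel (\<lambda>y. x + y)))"
      by (simp add: lborel_distr_plus)
    also have "\<dots> = (\<integral>\<^sup>+y. indicator A (y + x) * indicator B y \<partial>lborel)"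
      by (subst nn_integral_distr) (auto simp: add.commute)
    finally show "(\<integral>\<^sup>+y. indicator A (y + x) * indicator B y \<partial>lborel)
       = (\<integral>\<^sup>+y. indicator A y * indicator B (y - x) \<partial>lborel)" ..
  qed
  also have "\<dots> = (\<integral>\<^sup>+y. \<integral>\<^sup>+x. indicator A y * indicator B (y - x) \<partial>N \<partial>lborel)"
    by (rule P.Fubini'[symmetric]) measurable
  also have "\<dots> = (\<integral>\<^sup>+y. indicator A y * emeasure N B \<partial>lborel)"
  proof (rule nn_integral_cong)
    fix y :: 'a
    have "(\<integral>\<^sup>+x. indicator B (y - x) \<partial>N) = (\<integral>\<^sup>+x. indicator B (- y + x) \<partial>N)"
      by (intro nn_integral_cong) (simp add: B_def indicator_def norm_minus_commute)
    also have "\<dots> = (\<integral>\<^sup>+x. indicator B x \<partial>(distr N borel (\<lambda>x. - y + x)))"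
      by (subst nn_integral_distr) auto
    finally have "(\<integral>\<^sup>+x. indicator B (y - x) \<partial>N) = emeasure N B" by (simp only: inv) simp
    then show "(\<integral>\<^sup>+x. indicator A y * indicator B (y - x) \<partial>N) = indicator A y * emeasure N B"
      by (subst nn_integral_cmult) auto
  qed
  also have "\<dots> = emeasure lborel A * emeasure lborel B"
    by (simp add: nn_integral_multc ball B_def)
  finally have eq: "emeasure N A * emeasure lborel B = emeasure lborel A * emeasure lborel B" .
  have "emeasure lborel B = ennreal (measure lborel B)"
    using emeasure_lborel_ball_finite[of "0::'a" 1] by (simp add: B_def emeasure_eq_ennreal_measure)
  moreover have "0 < measure lborel B"
    unfolding B_def by (rule content_ball_pos) simp
  ultimately show "emeasure N A = emeasure lborel A"
    using eq by (simp add: mult_right_ennreal_cancel)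
qed

lemma frame_map_measurable [measurable]:
  "frame_map k p e \<in> borel_measurable (Pi\<^sub>M {..<k} (\<lambda>_. lborel))"
proof -
  have *: "frame_map k p e = (\<lambda>x. p + (\<Sum>i<k. x i *\<^sub>R e i))"
    by (simp add: fun_eq_iff frame_map_def)
  show ?thesis unfolding * by measurable
qed

lemma lborel_distr_orthogonal:
  fixes f :: "'a::euclidean_space \<Rightarrow> 'a"
  assumes f: "orthogonal_transformation f"
  shows "distr lborel borel f = lborel"
proof (rule translation_invariant_eq_lborel)
  have lin: "linear f" using f by (rule orthogonal_transformation_linear)
  have surj: "surj f" using f by (rule orthogonal_transformation_surj)
  have [measurable]: "f \<in> borel_measurable borel"
    by (intro borel_measurable_continuous_onI linear_continuous_on linear_linear[THEN iffD2] lin)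
  let ?N = "distr lborel borel f"
  show "distr ?N borel (\<lambda>x. c + x) = ?N" for c
  proof -
    obtain c' where c': "c = f c'" using surj by (metis surjD)
    have "distr ?N borel (\<lambda>x. c + x) = distr (distr lborel borel (\<lambda>x. c' + x)) borel f"
      by (simp add: distr_distr o_def c' linear_add[OF lin])
    then show ?thesis by (simp add: lborel_distr_plus)
  qed
  have pre: "f -` ball 0 r = ball 0 r" for r
    using orthogonal_transformation_norm[OF f] by auto
  show ball: "emeasure ?N (ball 0 1) = emeasure lborel (ball (0::'a) 1)"
    by (simp add: emeasure_distr pre)
  show "sigma_finite_measure ?N"
  proof
    show "\<exists>A. countable A \<and> A \<subseteq> sets ?N \<and> \<Union>A = space ?N \<and> (\<forall>a\<in>A. emeasure ?N a \<noteq> \<infinity>)"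
    proof (intro exI conjI ballI)
      show "countable (range (\<lambda>n. ball (0::'a) (real n)))" by simp
      show "\<Union> (range (\<lambda>n. ball (0::'a) (real n))) = space ?N"
        using reals_Archimedean2 by auto
      fix A assume "A \<in> range (\<lambda>n. ball (0::'a) (real n))"
      then show "emeasure ?N A \<noteq> \<infinity>"
        using emeasure_lborel_ball_finite[of "0::'a"] by (auto simp: emeasure_distr pre less_top)
    qed auto
  qed
qed simp

lemma orthonormal_frame_Basis:
  assumes "bij_betw b {..<n} (Basis :: 'a::euclidean_space set)"
  shows "orthonormal_frame n b"
proof -
  have "b i \<in> Basis" if "i < n" for i using assms that by (auto simp: bij_betw_def)
  then show ?thesis
    using assms unfolding orthonormal_frame_def by (auto simp: bij_betw_def inner_Basis inj_on_def)
qed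

lemma inner_frame_map:
  assumes "orthonormal_frame k e" "i < k"
  shows "frame_map k p e x \<bullet> e i = p \<bullet> e i + x i"
proof -
  have "frame_map k p e x \<bullet> e i = p \<bullet> e i + (\<Sum>j<k. x j * (e j \<bullet> e i))"
    by (simp add: frame_map_def inner_sum_left inner_add_left)
  also have "(\<Sum>j<k. x j * (e j \<bullet> e i)) = (\<Sum>j<k. if j = i then x j else 0)"
    using assms by (intro sum.cong) (auto simp: orthonormal_frame_def)
  finally show ?thesis using assms(2) by simp
qed

lemma distr_frame_map_Basis:
  assumes b: "bij_betw b {..<n} (Basis :: 'a::euclidean_space set)"
  shows "distr (Pi\<^sub>M {..<n} (\<lambda>_. lborel)) borel (frame_map n 0 b) = lborel"
proof (rule lborel_eqI[symmetric])
  fix l u :: 'a assume lu: "\<And>c. c \<in> Basis \<Longrightarrow> l \<bullet> c \<le> u \<bullet> c"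
  have bB: "b i \<in> Basis" if "i < n" for i using b that by (auto simp: bij_betw_def)
  have inner: "frame_map n 0 b x \<bullet> b i = x i" if "i < n" for x i
    using inner_frame_map[OF orthonormal_frame_Basis[OF b] that, of 0 x] by simp
  have "emeasure (distr (Pi\<^sub>M {..<n} (\<lambda>_. lborel)) borel (frame_map n 0 b)) (box l u)
      = emeasure (Pi\<^sub>M {..<n} (\<lambda>_. lborel)) (Pi\<^sub>E {..<n} (\<lambda>i. {l \<bullet> b i <..< u \<bullet> b i}))"
    apply (subst emeasure_distr)
      apply (simp_all add: box_def space_PiM)
    apply (rule arg_cong[where f="emeasure _"])
    apply (subst bij_betw_imp_surj_on[OF b, symmetric])
    by (auto simp: inner PiE_def)
  also have "\<dots> = (\<Prod>i<n. emeasure lborel {l \<bullet> b i <..< u \<bullet> b i})"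
    by (rule lborel_product.emeasure_PiM) auto
  also have "\<dots> = (\<Prod>i<n. ennreal ((u - l) \<bullet> b i))"
    using lu bB by (intro prod.cong) (auto simp: inner_diff_left)
  also have "\<dots> = (\<Prod>c\<in>Basis. ennreal ((u - l) \<bullet> c))"
    by (rule prod.reindex_bij_betw[OF b])
  also have "\<dots> = ennreal (\<Prod>c\<in>Basis. (u - l) \<bullet> c)"
    using lu by (intro prod_ennreal) (auto simp: inner_diff_left)
  finally show "emeasure (distr (Pi\<^sub>M {..<n} (\<lambda>_. lborel)) borel (frame_map n 0 b)) (box l u)
     = ennreal (\<Prod>c\<in>Basis. (u - l) \<bullet> c)" .
qed simp

text \<open>
  A frame differs from an enumeration of the standard basis by an orthogonal map and a translation,
  and both preserve Lebesgue measure.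
\<close>

lemma distr_frame_map:
  fixes e :: "nat \<Rightarrow> 'a::euclidean_space"
  assumes e: "orthonormal_frame n e" and n: "DIM('a) = n"
  shows "distr (Pi\<^sub>M {..<n} (\<lambda>_. lborel)) borel (frame_map n p e) = lborel"
proof -
  obtain b where b: "bij_betw b {..<n} (Basis :: 'a set)"
    using ex_bij_betw_nat_finite[of "Basis :: 'a set"] n by (auto simp: atLeast0LessThan)
  have ob: "orthonormal_frame n b" using b by (rule orthonormal_frame_Basis)
  define f where "f x = frame_map n 0 e (\<lambda>i. x \<bullet> b i)" for x
  have lin: "linear f"
    by (rule linearI)
      (simp_all add: f_def frame_map_def inner_add_left scaleR_add_left sum.distrib scaleR_sum_right)
  have f_frame: "f (frame_map n 0 b x) = frame_map n 0 e x" for x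
    unfolding f_def by (simp add: frame_map_def[of _ _ e] inner_frame_map[OF ob])
  have "f v \<bullet> f w = v \<bullet> w" for v w
  proof -
    have "f v \<bullet> f w = (\<Sum>i<n. (f v \<bullet> e i) * (w \<bullet> b i))"
      unfolding f_def[of w] by (simp add: frame_map_def inner_sum_right mult.commute)
    also have "\<dots> = (\<Sum>i<n. (v \<bullet> b i) * (w \<bullet> b i))"
      by (intro sum.cong refl) (simp add: f_def inner_frame_map[OF e])
    also have "\<dots> = v \<bullet> w"
      unfolding euclidean_inner[of v w] by (rule sum.reindex_bij_betw[OF b])
    finally show ?thesis .
  qed
  with lin have orth: "orthogonal_transformation f" by (simp add: orthogonal_transformation_def)
  have [measurable]: "f \<in> borel_measurable borel"
    by (intro borel_measurable_continuous_onI linear_continuous_on linear_linear[THEN iffD2] lin)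
  have "distr (Pi\<^sub>M {..<n} (\<lambda>_. lborel)) borel (frame_map n p e)
      = distr (distr (distr (Pi\<^sub>M {..<n} (\<lambda>_. lborel)) borel (frame_map n 0 b)) borel f) borel ((+) p)"
    by (simp add: distr_distr o_def f_frame) (simp add: frame_map_def[abs_def])
  then show ?thesis
    by (simp add: distr_frame_map_Basis[OF b] lborel_distr_orthogonal[OF orth] lborel_distr_plus)
qed

section \<open>Volume of sets in a hyperplane\<close>

text \<open>
  The quantity behind \<open>vol\<close> with the frame made explicit; it is extended real so that it can be integrated
  over slices before finiteness is known.
\<close>

definition chart_volume :: "nat \<Rightarrow> 'a::euclidean_space \<Rightarrow> (nat \<Rightarrow> 'a) \<Rightarrow> 'a set \<Rightarrow> ennreal" where
  "chart_volume k p e S =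
     emeasure (Pi\<^sub>M {..<k} (\<lambda>_. lborel)) {x \<in> {..<k} \<rightarrow>\<^sub>E UNIV. frame_map k p e x \<in> S}"

text \<open>
  The dimension is part of the notion: the frame then spans the whole hyperplane orthogonal to \<open>a\<close>, not
  merely a part of it.
\<close>

definition normal_frame :: "nat \<Rightarrow> 'a::euclidean_space \<Rightarrow> (nat \<Rightarrow> 'a) \<Rightarrow> bool" where
  "normal_frame k a e \<longleftrightarrow>
     DIM('a) = Suc k \<and> norm a = 1 \<and> orthonormal_frame k e \<and> (\<forall>i<k. a \<bullet> e i = 0)"

lemma chart_set_measurable [measurable]:
  assumes "S \<in> sets borel"
  shows "{x \<in> {..<k} \<rightarrow>\<^sub>E UNIV. frame_map k p e x \<in> S} \<in> sets (Pi\<^sub>M {..<k} (\<lambda>_. lborel))"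
proof -
  have "frame_map k p e -` S \<inter> space (Pi\<^sub>M {..<k} (\<lambda>_. lborel)) \<in> sets (Pi\<^sub>M {..<k} (\<lambda>_. lborel))"
    by (rule measurable_sets[OF frame_map_measurable assms])
  also have "frame_map k p e -` S \<inter> space (Pi\<^sub>M {..<k} (\<lambda>_. lborel))
      = {x \<in> {..<k} \<rightarrow>\<^sub>E UNIV. frame_map k p e x \<in> S}"
    by (auto simp: space_PiM)
  finally show ?thesis .
qed

lemma inner_normal_frame_map:
  assumes "normal_frame k a e"
  shows "a \<bullet> frame_map k p e x = a \<bullet> p"
  using assms by (simp add: frame_map_def normal_frame_def inner_add_right inner_sum_right)

text \<open>
  Cavalieri's principle: the frame completed by its unit normal is an orthonormal frame of the whole
  space, and Fubini's theorem splits off the normal coordinate.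
\<close>

lemma emeasure_lborel_slices:
  fixes a :: "'a::euclidean_space"
  assumes nf: "normal_frame k a e" and X: "X \<in> sets borel"
  shows "emeasure lborel X = (\<integral>\<^sup>+t. chart_volume k (p + t *\<^sub>R a) e X \<partial>lborel)"
proof -
  define f where "f = e(k := a)"
  have of: "orthonormal_frame (Suc k) f"
    using nf unfolding normal_frame_def orthonormal_frame_def f_def
    by (auto simp: less_Suc_eq norm_eq_1 inner_commute)
  let ?M = "Pi\<^sub>M {..<Suc k} (\<lambda>_. lborel :: real measure)"
  have fm: "frame_map (Suc k) p f (x(k := t)) = frame_map k (p + t *\<^sub>R a) e x" for x t
  proof -
    have "(\<Sum>i<k. (x(k := t)) i *\<^sub>R f i) = (\<Sum>i<k. x i *\<^sub>R e i)"
      by (intro sum.cong) (auto simp: f_def)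
    then show ?thesis by (simp add: frame_map_def) (simp add: f_def)
  qed
  have "emeasure lborel X = emeasure (distr ?M borel (frame_map (Suc k) p f)) X"
    using nf by (subst distr_frame_map[OF of]) (auto simp: normal_frame_def)
  also have "\<dots> = (\<integral>\<^sup>+x. indicator X (frame_map (Suc k) p f x) \<partial>?M)"
    using X nn_integral_distr[OF frame_map_measurable[of "Suc k" p f], of "indicator X"] by simp
  also have "\<dots> = (\<integral>\<^sup>+x. indicator X (frame_map (Suc k) p f x)
      \<partial>Pi\<^sub>M (insert k {..<k}) (\<lambda>_. lborel))"
    by (simp add: lessThan_Suc)
  also have "\<dots> = (\<integral>\<^sup>+t. \<integral>\<^sup>+x. indicator X (frame_map (Suc k) p f (x(k := t)))
      \<partial>Pi\<^sub>M {..<k} (\<lambda>_. lborel) \<partial>lborel)"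
    using X by (subst lborel_product.product_nn_integral_insert_rev) (auto simp flip: lessThan_Suc)
  also have "\<dots> = (\<integral>\<^sup>+t. chart_volume k (p + t *\<^sub>R a) e X \<partial>lborel)"
  proof (rule nn_integral_cong)
    fix t :: real
    have "(\<integral>\<^sup>+x. indicator X (frame_map (Suc k) p f (x(k := t))) \<partial>Pi\<^sub>M {..<k} (\<lambda>_. lborel))
        = (\<integral>\<^sup>+x. indicator {x \<in> {..<k} \<rightarrow>\<^sub>E UNIV. frame_map k (p + t *\<^sub>R a) e x \<in> X} x
            \<partial>Pi\<^sub>M {..<k} (\<lambda>_. lborel))"
      by (rule nn_integral_cong) (auto simp: fm indicator_def space_PiM)
    then show "(\<integral>\<^sup>+x. indicator X (frame_map (Suc k) p f (x(k := t))) \<partial>Pi\<^sub>M {..<k} (\<lambda>_. lborel))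
        = chart_volume k (p + t *\<^sub>R a) e X"
      using X by (simp add: chart_volume_def chart_set_measurable)
  qed
  finally show ?thesis .
qed

text \<open>
  The right-hand side, the volume of the right prism of height 1 over \<open>S\<close>, mentions neither the origin nor
  the frame; so it shows that the left-hand side depends on neither.
\<close>

lemma chart_volume_eq_prism:
  fixes a :: "'a::euclidean_space"
  assumes nf: "normal_frame k a e" and S: "closed S" "S \<subseteq> {x. a \<bullet> x = b}" and p: "a \<bullet> p = b"
  shows "chart_volume k p e S
       = emeasure lborel {x. b \<le> a \<bullet> x \<and> a \<bullet> x \<le> b + 1 \<and> x - (a \<bullet> x - b) *\<^sub>R a \<in> S}" (is "_ = emeasure lborel ?X")
proof -
  have aa: "a \<bullet> a = 1" using nf by (simp add: normal_frame_def norm_eq_1)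
  have "closed {x. b \<le> a \<bullet> x}" "closed {x. a \<bullet> x \<le> b + 1}"
    by (auto intro: closed_halfspace_le closed_halfspace_ge)
  moreover have "closed ((\<lambda>x. x - (a \<bullet> x - b) *\<^sub>R a) -` S)"
    by (intro continuous_closed_vimage S) (intro continuous_intros)
  ultimately have "closed ({x. b \<le> a \<bullet> x} \<inter> ({x. a \<bullet> x \<le> b + 1} \<inter> (\<lambda>x. x - (a \<bullet> x - b) *\<^sub>R a) -` S))"
    by (intro closed_Int)
  moreover have "?X = {x. b \<le> a \<bullet> x} \<inter> ({x. a \<bullet> x \<le> b + 1} \<inter> (\<lambda>x. x - (a \<bullet> x - b) *\<^sub>R a) -` S)"
    by auto
  ultimately have X: "?X \<in> sets borel" by simp
  have "emeasure lborel ?X = (\<integral>\<^sup>+t. chart_volume k (p + t *\<^sub>R a) e ?X \<partial>lborel)"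
    by (rule emeasure_lborel_slices[OF nf X])
  also have "\<dots> = (\<integral>\<^sup>+t. chart_volume k p e S * indicator {0..1::real} t \<partial>lborel)"
  proof (rule nn_integral_cong)
    fix t :: real
    have fm: "frame_map k (p + t *\<^sub>R a) e x = frame_map k p e x + t *\<^sub>R a" for x
      by (simp add: frame_map_def)
    have "frame_map k (p + t *\<^sub>R a) e x \<in> ?X \<longleftrightarrow> t \<in> {0..1} \<and> frame_map k p e x \<in> S" for x
    proof -
      have "a \<bullet> (frame_map k p e x + t *\<^sub>R a) = b + t"
        by (simp add: inner_add_right aa p inner_normal_frame_map[OF nf])
      then show ?thesis unfolding fm by simp
    qed
    then have "chart_volume k (p + t *\<^sub>R a) e ?X = emeasure (Pi\<^sub>M {..<k} (\<lambda>_. lborel))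
        {x \<in> {..<k} \<rightarrow>\<^sub>E UNIV. t \<in> {0..1} \<and> frame_map k p e x \<in> S}"
      by (simp only: chart_volume_def)
    then show "chart_volume k (p + t *\<^sub>R a) e ?X = chart_volume k p e S * indicator {0..1} t"
      by (cases "t \<in> {0..1}") (simp_all only: chart_volume_def, simp_all)
  qed
  also have "\<dots> = chart_volume k p e S" by (simp add: nn_integral_cmult_indicator)
  finally show ?thesis ..
qed

lemma orthonormal_frame_span:
  assumes e: "orthonormal_frame k (e :: nat \<Rightarrow> 'a::euclidean_space)"
  shows "range (frame_map k p e) = (\<lambda>v. p + v) ` span (e ` {..<k})"
    and "dim (span (e ` {..<k})) = k"
proof -
  have inj: "inj_on e {..<k}"
  proof (rule inj_onI)
    fix i j assume "i \<in> {..<k}" "j \<in> {..<k}" "e i = e j"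
    with e[unfolded orthonormal_frame_def, rule_format, of i j]
      e[unfolded orthonormal_frame_def, rule_format, of i i] show "i = j"
      by (auto split: if_splits)
  qed
  have ind: "independent (e ` {..<k})"
  proof (rule pairwise_orthogonal_independent)
    show "pairwise orthogonal (e ` {..<k})"
      using e unfolding pairwise_def orthogonal_def orthonormal_frame_def by auto
    show "0 \<notin> e ` {..<k}"
    proof
      assume "0 \<in> e ` {..<k}"
      then obtain i where "i < k" "e i = 0" by auto
      with e[unfolded orthonormal_frame_def, rule_format, of i i] show False by simp
    qed
  qed
  show "dim (span (e ` {..<k})) = k"
    using dim_eq_card_independent[OF ind] by (simp add: card_image[OF inj])
  have "frame_map k p e x - p \<in> span (e ` {..<k})" for x
    unfolding frame_map_def add_diff_cancel_left'
    by (intro span_sum span_scale span_base imageI)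
  moreover have "p + v \<in> range (frame_map k p e)" if v: "v \<in> span (e ` {..<k})" for v
  proof -
    obtain u where "v = (\<Sum>w\<in>e ` {..<k}. u w *\<^sub>R w)"
      using v by (auto simp: span_finite)
    then have "p + v = frame_map k p e (u \<circ> e)"
      by (simp add: frame_map_def sum.reindex[OF inj])
    then show ?thesis by blast
  qed
  ultimately show "range (frame_map k p e) = (\<lambda>v. p + v) ` span (e ` {..<k})"
    by (force simp: image_iff intro!: bexI[of _ "frame_map k p e _ - p"])
qed

lemma hyperplane_subspace_dim:
  fixes a :: "'a::euclidean_space"
  assumes "DIM('a) = Suc k" "norm a = 1"
  shows "subspace {x. a \<bullet> x = 0}" "dim {x. a \<bullet> x = 0} = k"
proof -
  have "a \<noteq> 0" using assms by auto
  then show "dim {x. a \<bullet> x = 0} = k" using assms dim_hyperplane[of a] by simp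
qed (rule subspace_hyperplane)

lemma range_normal_frame:
  assumes nf: "normal_frame k a e"
  shows "range (frame_map k p e) = {x. a \<bullet> x = a \<bullet> p}"
proof -
  have oe: "orthonormal_frame k e" and n: "DIM('a) = Suc k" "norm a = 1"
    using nf by (auto simp: normal_frame_def)
  have "span (e ` {..<k}) = {x. a \<bullet> x = 0}"
  proof (rule subspace_dim_equal)
    show "span (e ` {..<k}) \<subseteq> {x. a \<bullet> x = 0}"
      using nf by (intro span_minimal) (auto simp: hyperplane_subspace_dim[OF n] normal_frame_def)
  qed (simp_all add: hyperplane_subspace_dim[OF n] orthonormal_frame_span(2)[OF oe] del: dim_span)
  then have "range (frame_map k p e) = (\<lambda>v. p + v) ` {x. a \<bullet> x = 0}"
    by (simp add: orthonormal_frame_span[OF oe])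
  also have "\<dots> = {x. a \<bullet> x = a \<bullet> p}"
  proof (intro set_eqI iffI)
    fix x assume "x \<in> {x. a \<bullet> x = a \<bullet> p}"
    then show "x \<in> (\<lambda>v. p + v) ` {x. a \<bullet> x = 0}"
      by (intro image_eqI[of _ _ "x - p"]) (auto simp: inner_diff_right)
  qed (auto simp: inner_add_right)
  finally show ?thesis .
qed

text \<open>
  As \<open>S\<close> spans the hyperplane affinely, whichever frame is chosen in the definition of \<open>vol\<close> must span the
  same hyperplane, and hence is normal to the same \<open>a\<close>.
\<close>

lemma vol_eq_chart_volume:
  fixes a :: "'a::euclidean_space"
  assumes nf: "normal_frame k a e" and S: "closed S" "affine hull S = {x. a \<bullet> x = b}"
    and p: "a \<bullet> p = b"
  shows "vol k S = enn2real (chart_volume k p e S)"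
proof -
  have n: "DIM('a) = Suc k" "norm a = 1" and oe: "orthonormal_frame k e"
    using nf by (auto simp: normal_frame_def)
  have SH: "S \<subseteq> {x. a \<bullet> x = b}" using hull_subset[of S affine] S by simp
  have ex: "orthonormal_frame k e \<and> S \<subseteq> range (frame_map k p e)"
    using SH by (simp add: oe range_normal_frame[OF nf] p)
  obtain q f where qf: "(SOME (p, e). orthonormal_frame k e \<and> S \<subseteq> range (frame_map k p e)) = (q, f)"
    by fastforce
  have "case (q, f) of (p, e) \<Rightarrow> orthonormal_frame k e \<and> S \<subseteq> range (frame_map k p e)"
    unfolding qf[symmetric] by (rule someI[of _ "(p, e)"]) (use ex in simp)
  then have of: "orthonormal_frame k f" and Sf: "S \<subseteq> range (frame_map k q f)" by auto
  let ?V = "span (f ` {..<k})"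
  have "affine ((\<lambda>v. q + v) ` ?V)"
    by (intro affine_translation[THEN iffD1] subspace_imp_affine) simp
  with Sf have HR: "{x. a \<bullet> x = b} \<subseteq> (\<lambda>v. q + v) ` ?V"
    unfolding S(2)[symmetric] orthonormal_frame_span[OF of] by (rule hull_minimal)
  have "{x. a \<bullet> x = 0} = ?V"
  proof (rule subspace_dim_equal)
    show "{x. a \<bullet> x = 0} \<subseteq> ?V"
    proof
      fix x assume "x \<in> {x. a \<bullet> x = 0}"
      then have "p + x \<in> {x. a \<bullet> x = b}" "p \<in> {x. a \<bullet> x = b}"
        using p by (auto simp: inner_add_right)
      then obtain v w where "v \<in> ?V" "w \<in> ?V" "p + x = q + v" "p = q + w"
        using HR by blast
      then have "x = v - w" "v - w \<in> ?V" by (auto simp: algebra_simps span_diff)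
      then show "x \<in> ?V" by simp
    qed
  qed (simp_all add: hyperplane_subspace_dim[OF n] orthonormal_frame_span(2)[OF of] del: dim_span)
  then have "f i \<in> {x. a \<bullet> x = 0}" if "i < k" for i
    using that by (auto intro: span_base)
  then have "\<forall>i<k. a \<bullet> f i = 0" by simp
  with n of have nff: "normal_frame k a f" by (simp add: normal_frame_def)
  have "p \<in> range (frame_map k q f)"
    using HR p by (auto simp: orthonormal_frame_span[OF of])
  then have q: "a \<bullet> q = b" using p by (auto simp: range_normal_frame[OF nff])
  have "vol k S = enn2real (chart_volume k q f S)"
    using S(1) by (simp add: vol_def qf measure_completion[OF chart_set_measurable])
      (simp add: measure_def chart_volume_def)
  also have "chart_volume k q f S = chart_volume k p e S"
    using chart_volume_eq_prism[OF nff S(1) SH q] chart_volume_eq_prism[OF nf S(1) SH p] by simp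
  finally show ?thesis .
qed

lemma emeasure_PiM_scale:
  fixes c :: "nat \<Rightarrow> real"
  assumes c: "\<And>i. i < k \<Longrightarrow> c i > 0" and A: "A \<in> sets (Pi\<^sub>M {..<k} (\<lambda>_. lborel))"
  shows "emeasure (Pi\<^sub>M {..<k} (\<lambda>_. lborel)) A
       = ennreal (\<Prod>i<k. c i) * emeasure (Pi\<^sub>M {..<k} (\<lambda>_. lborel))
           {x \<in> {..<k} \<rightarrow>\<^sub>E UNIV. (\<lambda>i\<in>{..<k}. c i * x i) \<in> A}"
proof -
  let ?M = "Pi\<^sub>M {..<k} (\<lambda>_. lborel :: real measure)"
  let ?g = "\<lambda>x. \<lambda>i\<in>{..<k}. c i * x i"
  have g[measurable]: "?g \<in> measurable ?M ?M" by measurable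
  have "scale_measure (ennreal (\<Prod>i<k. c i)) (distr ?M ?M ?g) = ?M"
  proof (rule lborel_product.PiM_eqI)
    fix B :: "nat \<Rightarrow> real set" assume B: "\<And>i. i \<in> {..<k} \<Longrightarrow> B i \<in> sets lborel"
    have sc: "emeasure lborel (B i) = ennreal (c i) * emeasure lborel ((*) (c i) -` B i)" if i: "i < k" for i
    proof -
      have "distr lborel borel ((*) (c i)) = density lborel (\<lambda>_. inverse \<bar>c i\<bar>)"
        using c[OF i] by (intro lborel_distr_mult) auto
      then have "emeasure (distr lborel borel ((*) (c i))) (B i)
            = emeasure (density lborel (\<lambda>_. inverse \<bar>c i\<bar>)) (B i)" by simp
      then have "emeasure lborel ((*) (c i) -` B i) = ennreal (inverse (c i)) * emeasure lborel (B i)"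
        using B i c[OF i] by (simp add: emeasure_distr emeasure_density nn_integral_cmult_indicator)
      then have "ennreal (c i) * emeasure lborel ((*) (c i) -` B i)
          = (ennreal (c i) * ennreal (inverse (c i))) * emeasure lborel (B i)"
        by (simp add: mult.assoc)
      also have "ennreal (c i) * ennreal (inverse (c i)) = 1"
        using c[OF i] by (simp flip: ennreal_mult)
      finally show ?thesis by simp
    qed
    have "(*) (c i) -` B i \<in> sets lborel" if "i < k" for i
      using measurable_sets[of "(*) (c i)" borel borel "B i"] B that by simp
    then have "emeasure (distr ?M ?M ?g) (Pi\<^sub>E {..<k} B) = (\<Prod>i<k. emeasure lborel ((*) (c i) -` B i))"
      using B
      apply (subst emeasure_distr[OF g])
       apply (auto intro!: sets_PiM_I_finite)[1]
      apply (subst lborel_product.emeasure_PiM[symmetric])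
        apply auto[2]
      apply (rule arg_cong[where f="emeasure _"])
      by (auto simp: space_PiM PiE_def Pi_def extensional_def restrict_def)
    then show "emeasure (scale_measure (ennreal (\<Prod>i<k. c i)) (distr ?M ?M ?g)) (Pi\<^sub>E {..<k} B)
        = (\<Prod>i<k. emeasure lborel (B i))"
      using c prod_ennreal[of "{..<k}" c] by (simp add: sc prod.distrib less_imp_le)
  qed auto
  then have "emeasure ?M A = emeasure (scale_measure (ennreal (\<Prod>i<k. c i)) (distr ?M ?M ?g)) A"
    by simp
  also have "\<dots> = ennreal (\<Prod>i<k. c i) * emeasure ?M (?g -` A \<inter> space ?M)"
    using A by (simp add: emeasure_distr)
  also have "?g -` A \<inter> space ?M = {x \<in> {..<k} \<rightarrow>\<^sub>E UNIV. ?g x \<in> A}"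
    by (auto simp: space_PiM)
  finally show ?thesis .
qed

text \<open>
  If all slices of \<open>X\<close> orthogonal to \<open>a\<close> are images of one set \<open>S\<close> under diagonal scalings, their volumes are
  determinants times that of \<open>S\<close>, and Cavalieri's principle gives the volume of \<open>X\<close>. The scalings
  are only asked for at heights strictly between 0 and \<open>h\<close>: at the ends they may degenerate, as at the apex of
  a cone.
\<close>

lemma emeasure_scaled_slices:
  fixes a :: "'a::euclidean_space"
  assumes nf: "normal_frame k a e" and X: "X \<in> sets borel"
    and bounds: "\<And>x. x \<in> X \<Longrightarrow> a \<bullet> q \<le> a \<bullet> x \<and> a \<bullet> x \<le> a \<bullet> q + h"
    and c: "\<And>t i. 0 < t \<Longrightarrow> t < h \<Longrightarrow> i < k \<Longrightarrow> c t i > 0"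
    and scaled: "\<And>t x. 0 < t \<Longrightarrow> t < h \<Longrightarrow>
      frame_map k (q + t *\<^sub>R a) e (\<lambda>i. c t i * x i) \<in> X \<longleftrightarrow> frame_map k p e x \<in> S"
    and w: "\<And>t. 0 < t \<Longrightarrow> t < h \<Longrightarrow> w t = (\<Prod>i<k. c t i)"
    and w0: "\<And>t. 0 \<le> t \<Longrightarrow> t \<le> h \<Longrightarrow> 0 \<le> w t"
    and wm: "w \<in> borel_measurable borel" and I: "(w has_integral I) {0..h}"
  shows "emeasure lborel X = ennreal I * chart_volume k p e S"
proof -
  have aa: "a \<bullet> a = 1" using nf by (simp add: normal_frame_def norm_eq_1)
  have slice: "chart_volume k (q + t *\<^sub>R a) e X
      = ennreal (w t) * indicator {0..h} t * chart_volume k p e S" if "t \<noteq> 0" "t \<noteq> h" for t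
  proof (cases "0 < t \<and> t < h")
    case True
    let ?A = "{x \<in> {..<k} \<rightarrow>\<^sub>E UNIV. frame_map k (q + t *\<^sub>R a) e x \<in> X}"
    have "chart_volume k (q + t *\<^sub>R a) e X
       = ennreal (\<Prod>i<k. c t i) * emeasure (Pi\<^sub>M {..<k} (\<lambda>_. lborel))
           {x \<in> {..<k} \<rightarrow>\<^sub>E UNIV. (\<lambda>i\<in>{..<k}. c t i * x i) \<in> ?A}"
      unfolding chart_volume_def using True
      by (intro emeasure_PiM_scale c chart_set_measurable X) auto
    also have "{x \<in> {..<k} \<rightarrow>\<^sub>E UNIV. (\<lambda>i\<in>{..<k}. c t i * x i) \<in> ?A}
       = {x \<in> {..<k} \<rightarrow>\<^sub>E UNIV. frame_map k p e x \<in> S}"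
    proof -
      have "frame_map k (q + t *\<^sub>R a) e (\<lambda>i\<in>{..<k}. c t i * x i)
          = frame_map k (q + t *\<^sub>R a) e (\<lambda>i. c t i * x i)" for x
        by (simp add: frame_map_def)
      then show ?thesis using scaled True by auto
    qed
    finally show ?thesis using True w by (simp add: chart_volume_def)
  next
    case False
    then have "frame_map k (q + t *\<^sub>R a) e x \<notin> X" for x
      using bounds[of "frame_map k (q + t *\<^sub>R a) e x"] that
      by (auto simp: inner_normal_frame_map[OF nf] inner_add_right aa)
    then show ?thesis using False that by (auto simp: chart_volume_def)
  qed
  have "emeasure lborel X = (\<integral>\<^sup>+t. chart_volume k (q + t *\<^sub>R a) e X \<partial>lborel)"
    by (rule emeasure_lborel_slices[OF nf X])
  also have "\<dots> = (\<integral>\<^sup>+t. ennreal (w t) * indicator {0..h} t * chart_volume k p e S \<partial>lborel)"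
    by (rule nn_integral_cong_AE) (use AE_lborel_singleton[of 0] AE_lborel_singleton[of h] in
      \<open>eventually_elim, auto simp: slice\<close>)
  also have "\<dots> = (\<integral>\<^sup>+t. ennreal (w t) * indicator {0..h} t \<partial>lborel) * chart_volume k p e S"
    using wm by (intro nn_integral_multc) auto
  also have "(\<integral>\<^sup>+t. ennreal (w t) * indicator {0..h} t \<partial>lborel) = ennreal I"
    using w0 by (intro nn_integral_has_integral_lebesgue' I) auto
  finally show ?thesis .
qed

lemma ex_normal_frame:
  fixes a :: "'a::euclidean_space"
  assumes n: "DIM('a) = Suc k" "norm a = 1"
  shows "\<exists>e. normal_frame k a e"
proof -
  obtain B where B: "B \<subseteq> {x. a \<bullet> x = 0}" "pairwise orthogonal B" "\<And>x. x \<in> B \<Longrightarrow> norm x = 1"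
    "independent B" "card B = dim {x. a \<bullet> x = 0}" "span B = {x. a \<bullet> x = 0}"
    using orthonormal_basis_subspace[OF hyperplane_subspace_dim(1)[OF n]] by metis
  have "finite B" "card B = k"
    using B(4,5) by (simp_all add: independent_imp_finite hyperplane_subspace_dim[OF n])
  then obtain e where e: "bij_betw e {..<k} B"
    using ex_bij_betw_nat_finite[of B] by (auto simp: atLeast0LessThan)
  then have eB: "e i \<in> B" if "i < k" for i using that by (auto simp: bij_betw_def)
  have "e i \<bullet> e j = (if i = j then 1 else 0)" if "i < k" "j < k" for i j
  proof (cases "i = j")
    case True
    then show ?thesis using B(3)[OF eB[OF that(1)]] by (simp add: norm_eq_1)
  next
    case False
    then have "e i \<noteq> e j" using e that by (auto simp: bij_betw_def inj_on_def)
    then show ?thesis using False eB that B(2) by (auto simp: pairwise_def orthogonal_def)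
  qed
  with n eB B(1) show ?thesis
    by (intro exI[of _ e]) (auto simp: normal_frame_def orthonormal_frame_def)
qed

section \<open>Simplices given by their barycentric coordinates\<close>

text \<open>
  The vectors \<open>g i\<close> form a dual system of the vertices: \<open>g i \<bullet> x - \<kappa> i\<close> is the \<open>i\<close>-th barycentric coordinate
  of \<open>x\<close>. With it, membership in the simplex and in its faces becomes a system of linear
  inequalities, which is what the slicing arguments need.
\<close>

locale barycentric_simplex =
  fixes I :: "'i set" and V g :: "'i \<Rightarrow> 'a::euclidean_space" and \<kappa> :: "'i \<Rightarrow> real"
  assumes finite_index: "finite I" and card_index: "card I = Suc (DIM('a))"
    and dual: "\<And>i j. i \<in> I \<Longrightarrow> j \<in> I \<Longrightarrow> g i \<bullet> V j = \<kappa> i + (if i = j then 1 else 0)"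
begin

lemma inj_vertices: "inj_on V I"
proof (rule inj_onI)
  fix i j assume "i \<in> I" "j \<in> I" "V i = V j"
  then show "i = j" using dual[of i i] dual[of i j] by (auto split: if_splits)
qed

text \<open>
  Applying the dual vector to a linear combination recovers a coefficient; this makes the vertices affinely
  independent and identifies the coefficients of affine combinations.
\<close>

lemma coordinate_combination:
  assumes i: "i \<in> I" and J: "J \<subseteq> I"
  shows "g i \<bullet> (\<Sum>j\<in>J. u j *\<^sub>R V j) = \<kappa> i * sum u J + (if i \<in> J then u i else 0)"
proof -
  have fJ: "finite J" using J finite_index finite_subset by blast
  have "g i \<bullet> (\<Sum>j\<in>J. u j *\<^sub>R V j) = (\<Sum>j\<in>J. u j * (\<kappa> i + (if i = j then 1 else 0)))"
    using i J by (auto simp: inner_sum_right dual intro!: sum.cong)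
  also have "\<dots> = (\<Sum>j\<in>J. \<kappa> i * u j) + (\<Sum>j\<in>J. if i = j then u j else 0)"
    by (subst sum.distrib[symmetric]) (auto intro!: sum.cong simp: algebra_simps)
  finally show ?thesis using fJ by (simp add: sum_distrib_left)
qed

lemma affine_independent_vertices: "\<not> affine_dependent (V ` I)"
proof
  assume "affine_dependent (V ` I)"
  then obtain U where U: "sum U (V ` I) = 0" "\<exists>v\<in>V ` I. U v \<noteq> 0" "(\<Sum>v\<in>V ` I. U v *\<^sub>R v) = 0"
    using finite_index by (auto simp: affine_dependent_explicit_finite)
  then have s: "(\<Sum>i\<in>I. U (V i)) = 0" "(\<Sum>i\<in>I. U (V i) *\<^sub>R V i) = 0"
    by (simp_all add: sum.reindex[OF inj_vertices])
  have "U (V i) = 0" if "i \<in> I" for i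
    using coordinate_combination[OF that subset_refl, of "\<lambda>i. U (V i)"] s that by simp
  with U(2) show False by auto
qed

lemma barycentric:
  shows "(\<Sum>i\<in>I. g i \<bullet> x - \<kappa> i) = 1" and "(\<Sum>i\<in>I. (g i \<bullet> x - \<kappa> i) *\<^sub>R V i) = x"
proof -
  have "affine hull (V ` I) = UNIV"
    using affine_independent_vertices
    by (rule affine_independent_span_eq) (simp add: card_image[OF inj_vertices] card_index)
  then have "x \<in> affine hull (V ` I)" by simp
  then obtain u where u: "sum u (V ` I) = 1" "(\<Sum>v\<in>V ` I. u v *\<^sub>R v) = x"
    using finite_index by (auto simp: affine_hull_finite)
  have s: "(\<Sum>i\<in>I. u (V i)) = 1" "(\<Sum>i\<in>I. u (V i) *\<^sub>R V i) = x"
    using u by (simp_all add: sum.reindex[OF inj_vertices])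
  have c: "g i \<bullet> x - \<kappa> i = u (V i)" if "i \<in> I" for i
    using coordinate_combination[OF that subset_refl, of "\<lambda>i. u (V i)"] s that by simp
  show "(\<Sum>i\<in>I. g i \<bullet> x - \<kappa> i) = 1" "(\<Sum>i\<in>I. (g i \<bullet> x - \<kappa> i) *\<^sub>R V i) = x"
    using s by (simp_all add: c)
qed

lemma barycentric_face:
  assumes J: "J \<subseteq> I" and x: "\<forall>i\<in>I - J. g i \<bullet> x = \<kappa> i"
  shows "(\<Sum>i\<in>J. g i \<bullet> x - \<kappa> i) = 1" and "(\<Sum>i\<in>J. (g i \<bullet> x - \<kappa> i) *\<^sub>R V i) = x"
proof -
  have "(\<Sum>i\<in>J. g i \<bullet> x - \<kappa> i) = (\<Sum>i\<in>I. g i \<bullet> x - \<kappa> i)"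
    by (rule sum.mono_neutral_left) (use finite_index J x in auto)
  then show "(\<Sum>i\<in>J. g i \<bullet> x - \<kappa> i) = 1" by (simp add: barycentric)
  have "(\<Sum>i\<in>J. (g i \<bullet> x - \<kappa> i) *\<^sub>R V i) = (\<Sum>i\<in>I. (g i \<bullet> x - \<kappa> i) *\<^sub>R V i)"
    by (rule sum.mono_neutral_left) (use finite_index J x in auto)
  then show "(\<Sum>i\<in>J. (g i \<bullet> x - \<kappa> i) *\<^sub>R V i) = x" by (simp add: barycentric)
qed

lemma affine_hull_face:
  assumes J: "J \<subseteq> I"
  shows "affine hull (V ` J) = {x. \<forall>i\<in>I - J. g i \<bullet> x = \<kappa> i}"
proof (intro set_eqI iffI)
  have inj: "inj_on V J" and fJ: "finite J"
    using J inj_vertices finite_index by (auto intro: inj_on_subset finite_subset)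
  {
    fix x assume "x \<in> affine hull (V ` J)"
    then obtain u where u: "sum u (V ` J) = 1" "(\<Sum>v\<in>V ` J. u v *\<^sub>R v) = x"
      using fJ by (auto simp: affine_hull_finite)
    have s: "(\<Sum>i\<in>J. u (V i)) = 1" "(\<Sum>i\<in>J. u (V i) *\<^sub>R V i) = x"
      using u by (simp_all add: sum.reindex[OF inj])
    show "x \<in> {x. \<forall>i\<in>I - J. g i \<bullet> x = \<kappa> i}"
      using coordinate_combination[OF _ J, of _ "\<lambda>i. u (V i)"] s by simp
  next
    fix x assume x: "x \<in> {x. \<forall>i\<in>I - J. g i \<bullet> x = \<kappa> i}"
    let ?u = "\<lambda>v. g (inv_into J V v) \<bullet> x - \<kappa> (inv_into J V v)"
    have "sum ?u (V ` J) = 1" "(\<Sum>v\<in>V ` J. ?u v *\<^sub>R v) = x"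
      using x by (simp_all add: sum.reindex[OF inj] inv_into_f_f[OF inj] barycentric_face[OF J, of x])
    then show "x \<in> affine hull (V ` J)"
      using fJ by (auto simp: affine_hull_finite)
  }
qed

lemma convex_hull_face:
  assumes J: "J \<subseteq> I"
  shows "convex hull (V ` J) = {x. (\<forall>i\<in>J. \<kappa> i \<le> g i \<bullet> x) \<and> (\<forall>i\<in>I - J. g i \<bullet> x = \<kappa> i)}"
    (is "_ = ?F")
proof
  have fJ: "finite J" using J finite_index by (rule finite_subset)
  have eq: "?F = (\<Inter>i\<in>J. {x. g i \<bullet> x \<ge> \<kappa> i}) \<inter> (\<Inter>i\<in>I - J. {x. g i \<bullet> x = \<kappa> i})"
    by auto
  have "convex ?F"
    unfolding eq
    by (intro convex_Int convex_INT ballI convex_halfspace_ge convex_hyperplane)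
  then show "convex hull (V ` J) \<subseteq> ?F"
    by (intro hull_minimal) (use J in \<open>auto simp: dual subset_iff\<close>)
  show "?F \<subseteq> convex hull (V ` J)"
  proof
    fix x assume x: "x \<in> ?F"
    then have "(\<Sum>i\<in>J. (g i \<bullet> x - \<kappa> i) *\<^sub>R V i) \<in> convex hull (V ` J)"
      using fJ by (intro convex_sum) (auto intro: hull_inc simp: barycentric_face[OF J, of x])
    then show "x \<in> convex hull (V ` J)" using x by (simp add: barycentric_face[OF J, of x])
  qed
qed

definition T where "T = convex hull (V ` I)"

lemma mem_T: "x \<in> T \<longleftrightarrow> (\<forall>i\<in>I. \<kappa> i \<le> g i \<bullet> x)"
  by (simp add: T_def convex_hull_face[OF subset_refl])

lemma compact_T: "compact T"
  unfolding T_def using finite_index by (intro finite_imp_compact_convex_hull) simp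

lemma interior_T: "(\<And>i. i \<in> I \<Longrightarrow> \<kappa> i < g i \<bullet> x) \<Longrightarrow> x \<in> interior T"
proof -
  assume x: "\<And>i. i \<in> I \<Longrightarrow> \<kappa> i < g i \<bullet> x"
  have "open (\<Inter>i\<in>I. {x. \<kappa> i < g i \<bullet> x})"
    using finite_index by (intro open_INT) (auto intro: open_halfspace_gt)
  then show ?thesis
    by (rule interiorI) (use x in \<open>auto simp: mem_T less_imp_le\<close>)
qed

lemma simplex_T: "int DIM('a) simplex T"
  unfolding T_def
  by (rule simplex_convex_hull)
    (simp add: affine_independent_vertices card_image[OF inj_vertices] card_index)

lemma edge_T:
  assumes "i \<in> I" "j \<in> I" "i \<noteq> j"
  shows "closed_segment (V i) (V j) edge_of T"
  unfolding edge_of_def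
proof
  show "closed_segment (V i) (V j) face_of T"
    unfolding T_def face_of_convex_hull_affine_independent[OF affine_independent_vertices]
    using assms by (intro exI[of _ "{V i, V j}"]) (simp add: segment_convex_hull)
  have "V i \<noteq> V j" using assms inj_vertices by (auto simp: inj_on_def)
  then show "aff_dim (closed_segment (V i) (V j)) = 1"
    by (simp add: segment_convex_hull aff_dim_convex_hull aff_dim_2)
qed

lemma facet_T:
  assumes "G facet_of T"
  obtains i where "i \<in> I" "G = convex hull (V ` (I - {i}))"
proof -
  obtain i where i: "i \<in> I" "G = convex hull (V ` I - {V i})"
    using assms unfolding T_def facet_of_convex_hull_affine_independent[OF affine_independent_vertices]
    by auto
  moreover have "V ` I - {V i} = V ` (I - {i})"
    using i(1) inj_vertices by (auto simp: inj_on_def)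
  ultimately show ?thesis using that by simp
qed

text \<open>
  The volume formula for a cone, with the height of the vertex \<open>V i\<close> over the opposite facet expressed as
  \<open>1 / norm (g i)\<close>: the coordinate \<open>i\<close> drops from 1 at the vertex to 0 on the facet.
\<close>

lemma measure_T_facet:
  assumes i: "i \<in> I" and k: "DIM('a) = Suc k"
  shows "measure lborel T * (norm (g i) * DIM('a)) = vol k (convex hull (V ` (I - {i})))"
proof -
  let ?G = "convex hull (V ` (I - {i}))"
  let ?r = "norm (g i)"
  have "I \<noteq> {i}" using card_index k by auto
  then obtain j where j: "j \<in> I" "j \<noteq> i" using i by blast
  have "g i \<noteq> 0" using dual[OF i i] dual[OF i j(1)] j by auto
  then have r: "?r > 0" by simp
  \<comment> \<open>The unit normal points from the vertex to the facet, so slices are parametrised by their distance from the vertex.\<close>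
  define a where "a = - (1 / ?r) *\<^sub>R g i"
  have na: "norm a = 1" using r by (simp add: a_def)
  obtain e where nf: "normal_frame k a e" using ex_normal_frame[OF k na] by blast
  define h where "h = 1 / ?r"
  have h: "h > 0" using r by (simp add: h_def)
  define q where "q = V i"
  define p where "p = q + h *\<^sub>R a"
  have aa: "a \<bullet> a = 1" using na by (simp add: norm_eq_1)
  have gi: "g i \<bullet> x = - ?r * (a \<bullet> x)" for x using r by (simp add: a_def)
  have gq: "g l \<bullet> q = \<kappa> l + (if l = i then 1 else 0)" if "l \<in> I" for l
    using that i by (simp add: q_def dual)
  have G: "x \<in> ?G \<longleftrightarrow> (\<forall>l\<in>I - {i}. \<kappa> l \<le> g l \<bullet> x) \<and> g i \<bullet> x = \<kappa> i" for x
    using i by (subst convex_hull_face) auto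
  have gp: "g i \<bullet> y = \<kappa> i \<longleftrightarrow> a \<bullet> y = a \<bullet> p" for y
  proof -
    have "?r * (a \<bullet> p) = ?r * (a \<bullet> q) + 1" using r by (simp add: p_def inner_add_right aa h_def field_simps)
    moreover have "- ?r * (a \<bullet> q) = \<kappa> i + 1" using gq[OF i] gi by simp
    ultimately have "- ?r * (a \<bullet> p) = \<kappa> i" by (simp add: algebra_simps)
    then have "g i \<bullet> y = \<kappa> i \<longleftrightarrow> ?r * (a \<bullet> y) = ?r * (a \<bullet> p)" using gi[of y] by linarith
    then show ?thesis using r by simp
  qed
  have clG: "closed ?G"
    using finite_index by (intro compact_imp_closed finite_imp_compact_convex_hull) simp
  have affG: "affine hull ?G = {x. a \<bullet> x = a \<bullet> p}"
  proof -
    have "I - (I - {i}) = {i}" using i by auto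
    then show ?thesis by (simp add: affine_hull_face gp)
  qed
  have volG: "vol k ?G = enn2real (chart_volume k p e ?G)"
    by (rule vol_eq_chart_volume[OF nf clG affG refl])
  have int: "((\<lambda>t. (t / h) ^ k) has_integral (h / Suc k)) {0..h}"
  proof -
    define F where "F t = (1 / (h ^ k * Suc k)) * t ^ Suc k" for t
    have "(F has_real_derivative (t / h) ^ k) (at t within {0..h})" for t
    proof -
      have "((\<lambda>t. t ^ Suc k) has_real_derivative real (Suc k) * t ^ k) (at t within {0..h})"
        using DERIV_pow[of "Suc k" t] by simp
      from DERIV_cmult[OF this, of "1 / (h ^ k * Suc k)"] show ?thesis
        unfolding F_def by (simp add: power_divide del: of_nat_Suc)
    qed
    then have "((\<lambda>t. (t / h) ^ k) has_integral (F h - F 0)) {0..h}"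
      using h by (intro fundamental_theorem_of_calculus)
        (auto simp flip: has_real_derivative_iff_has_vector_derivative)
    then show ?thesis using h by (simp add: F_def del: of_nat_Suc)
  qed
  have "emeasure lborel T = ennreal (h / Suc k) * chart_volume k p e ?G"
  proof (rule emeasure_scaled_slices[OF nf, where q = q and h = h and c = "\<lambda>t _. t / h"])
    show "T \<in> sets borel" using compact_T by (simp add: compact_imp_closed borel_closed)
    show "a \<bullet> q \<le> a \<bullet> x \<and> a \<bullet> x \<le> a \<bullet> q + h" if "x \<in> T" for x
    proof -
      have pos: "g l \<bullet> x - \<kappa> l \<ge> 0" if "l \<in> I" for l using \<open>x \<in> T\<close> that by (simp add: mem_T)
      have "g i \<bullet> x - \<kappa> i \<le> (\<Sum>l\<in>I. g l \<bullet> x - \<kappa> l)"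
        by (rule member_le_sum) (use pos i finite_index in auto)
      then have "g i \<bullet> x - \<kappa> i \<le> 1" by (simp add: barycentric)
      then have "g i \<bullet> x \<le> g i \<bullet> q" "g i \<bullet> q - 1 \<le> g i \<bullet> x"
        using pos[OF i] gq[OF i] by auto
      then have "?r * (a \<bullet> q) \<le> ?r * (a \<bullet> x)" "?r * (a \<bullet> x) \<le> ?r * (a \<bullet> q + h)"
        using r by (simp_all add: gi distrib_left h_def)
      then show ?thesis using r by simp
    qed
    show "frame_map k (q + t *\<^sub>R a) e (\<lambda>i. t / h * x i) \<in> T \<longleftrightarrow> frame_map k p e x \<in> ?G"
      if t: "0 < t" "t < h" for t x
    proof -
      define y where "y = frame_map k p e x"
      define s where "s = t / h"
      have s: "0 < s" "s < 1" using t by (auto simp: s_def)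
      have "frame_map k (q + t *\<^sub>R a) e (\<lambda>i. t / h * x i) = q + s *\<^sub>R (y - q)"
        using h by (simp add: frame_map_def y_def p_def s_def scaleR_sum_right algebra_simps)
      moreover have "g i \<bullet> y = \<kappa> i"
        using inner_normal_frame_map[OF nf] by (simp add: gp y_def)
      \<comment> \<open>The other coordinates vanish at the vertex, hence are merely multiplied by the positive factor.\<close>
      moreover have "\<kappa> l \<le> g l \<bullet> (q + s *\<^sub>R (y - q)) \<longleftrightarrow> \<kappa> l \<le> g l \<bullet> y" if "l \<in> I" "l \<noteq> i" for l
        using that s by (simp add: inner_add_right inner_diff_right gq zero_le_mult_iff)
      moreover have "\<kappa> i \<le> g i \<bullet> (q + s *\<^sub>R (y - q))"
        using s i \<open>g i \<bullet> y = \<kappa> i\<close> by (simp add: inner_add_right inner_diff_right gq)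
      ultimately show ?thesis
        using i unfolding y_def[symmetric] by (auto simp: mem_T G)
    qed
  qed (use h int in auto)
  moreover have fin: "emeasure lborel T < \<infinity>"
    using emeasure_lborel_cbox_finite emeasure_bounded_finite[of T] compact_T compact_imp_bounded by blast
  ultimately have "measure lborel T = h / Suc k * vol k ?G"
    using h unfolding measure_def volG by (simp add: enn2real_mult)
  then show ?thesis using r k by (simp add: h_def del: of_nat_Suc)
qed

end

section \<open>The join of two orthogonal simplices\<close>

text \<open>
  This is \<open>4 ^ d < (d + 1) * (2d choose d)\<close>, the inequality that decides in favour of the middle section. For
  \<open>d = 1\<close> both sides are equal.
\<close>

lemma central_binomial_factorials:
  assumes "d \<ge> 2"
  shows "4 ^ d * (fact d)\<^sup>2 < (real d + 1) * fact (2 * d)"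
  using assms
proof (induction d rule: dec_induct)
  case base
  show ?case by (simp add: fact_numeral)
next
  case (step d)
  have "4 ^ Suc d * (fact (Suc d))\<^sup>2 = 4 * (real d + 1)\<^sup>2 * (4 ^ d * (fact d)\<^sup>2)"
    by (simp add: power2_eq_square algebra_simps)
  also have "\<dots> < 4 * (real d + 1)\<^sup>2 * ((real d + 1) * fact (2 * d))"
    using step by (intro mult_strict_left_mono) auto
  also have "\<dots> \<le> (real d + 2) * (2 * real d + 2) * (2 * real d + 1) * fact (2 * d)"
  proof -
    have "4 * (real d + 1)\<^sup>2 * (real d + 1) \<le> (real d + 2) * (2 * real d + 2) * (2 * real d + 1)"
      by (simp add: power2_eq_square algebra_simps)
    from mult_right_mono[OF this, of "fact (2 * d)"] show ?thesis by (simp add: mult.assoc)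
  qed
  also have "\<dots> = (real (Suc d) + 1) * fact (2 * Suc d)"
    by (simp add: algebra_simps)
  finally show ?case .
qed

lemma has_integral_Beta_nat:
  assumes "d > 0"
  shows "((\<lambda>t. (2 * (1 - t)) ^ d * (2 * t) ^ d) has_integral
           (4 ^ d * (fact d)\<^sup>2 / fact (2 * d + 1))) {0..1::real}"
proof -
  have "((\<lambda>t. t powr (real d + 1 - 1) * (1 - t) powr (real d + 1 - 1))
      has_integral Beta (real d + 1) (real d + 1)) {0..1}"
    by (rule has_integral_Beta_real) auto
  then have "((\<lambda>t. 4 ^ d * (t powr real d * (1 - t) powr real d))
      has_integral 4 ^ d * Beta (real d + 1) (real d + 1)) {0..1}"
    by (intro has_integral_mult_right) simp
  moreover have "Beta (real d + 1) (real d + 1) = (fact d)\<^sup>2 / fact (2 * d + 1)"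
  proof -
    have "Gamma (real d + 1) = fact d" using Gamma_fact[of d, where 'a = real] by (simp add: add.commute)
    moreover have "Gamma (real d + 1 + (real d + 1)) = fact (2 * d + 1)"
      using Gamma_fact[of "2 * d + 1", where 'a = real] by (simp add: add_ac)
    ultimately show ?thesis by (simp add: Beta_def power2_eq_square del: fact_Suc)
  qed
  moreover have "4 ^ d * (t powr real d * (1 - t) powr real d) = (2 * (1 - t)) ^ d * (2 * t) ^ d"
    if "t \<in> {0..1}" for t :: real
  proof -
    have "s powr real d = s ^ d" if "s \<ge> 0" for s :: real
      using that assms by (cases "s = 0") (auto simp: powr_realpow)
    then have "4 ^ d * (t powr real d * (1 - t) powr real d) = (4 * (t * (1 - t))) ^ d"
      using that by (simp add: power_mult_distrib)
    also have "4 * (t * (1 - t)) = (2 * (1 - t)) * (2 * t)" by simp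
    finally show ?thesis by (simp only: power_mult_distrib)
  qed
  ultimately show ?thesis
    by (subst has_integral_cong[symmetric]) (auto simp del: fact_Suc)
qed

text \<open>
  The vectors \<open>b 0, ..., b (d - 1)\<close> carry the simplex \<open>A\<close>, the next \<open>d\<close> ones carry \<open>B\<close>, and the last one is
  the direction of the join.
\<close>

locale two_orthogonal_simplices =
  fixes d :: nat and b :: "nat \<Rightarrow> 'a::euclidean_space" and R :: real
  assumes d: "d \<ge> 2" and dim: "DIM('a) = 2 * d + 1" and b: "orthonormal_frame (2 * d + 1) b"
    and R: "R > 0"
begin

definition "join_axis = b (2 * d)"

text \<open>
  The Boolean selects the simplex: \<open>False\<close> for \<open>A\<close> at height 0, \<open>True\<close> for \<open>B\<close> at height 1.
\<close>

definition basis :: "bool \<Rightarrow> nat \<Rightarrow> 'a" where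
  "basis s j = b (if s then d + j else j)"

text \<open>
  The gradients of the barycentric coordinates of the standard simplex with vertices \<open>basis s j\<close> for \<open>j < d\<close>
  and 0; the index \<open>d\<close> belongs to the vertex 0.
\<close>

definition dual_vec :: "bool \<Rightarrow> nat \<Rightarrow> 'a" where
  "dual_vec s j = (if j < d then basis s j else - (\<Sum>i<d. basis s i))"

text \<open>
  That standard simplex, moved so that its centroid is at the origin. It need not be regular: only the
  position of the centroid enters the comparison of volumes.
\<close>

definition base_vertex :: "bool \<Rightarrow> nat \<Rightarrow> 'a" where
  "base_vertex s j = (if j < d then basis s j else 0) - (1 / (real d + 1)) *\<^sub>R (\<Sum>i<d. basis s i)"

definition vertex :: "bool \<times> nat \<Rightarrow> 'a" where
  "vertex = (\<lambda>(s, j). R *\<^sub>R base_vertex s j + (if s then join_axis else 0))"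

definition gradient :: "bool \<times> nat \<Rightarrow> 'a" where
  "gradient = (\<lambda>(s, j). (1 / R) *\<^sub>R dual_vec s j + ((if s then 1 else -1) / (real d + 1)) *\<^sub>R join_axis)"

definition offset :: "bool \<times> nat \<Rightarrow> real" where
  "offset = (\<lambda>(s, j). if s then 0 else - 1 / (real d + 1))"

lemma inner_b: "i \<le> 2 * d \<Longrightarrow> j \<le> 2 * d \<Longrightarrow> b i \<bullet> b j = (if i = j then 1 else 0)"
  using b by (simp add: orthonormal_frame_def)

lemma inner_basis:
  "i < d \<Longrightarrow> j < d \<Longrightarrow> basis s i \<bullet> basis s' j = (if s = s' \<and> i = j then 1 else 0)"
  by (auto simp: basis_def inner_b)

lemma inner_axis: "i < d \<Longrightarrow> basis s i \<bullet> join_axis = 0" "join_axis \<bullet> join_axis = 1"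
  by (auto simp: basis_def join_axis_def inner_b)

lemma inner_axis_dual: "dual_vec s j \<bullet> join_axis = 0" "join_axis \<bullet> dual_vec s j = 0"
proof -
  show "dual_vec s j \<bullet> join_axis = 0"
    by (simp add: dual_vec_def inner_axis inner_sum_left)
  then show "join_axis \<bullet> dual_vec s j = 0" by (simp only: inner_commute)
qed

lemma inner_axis_base: "base_vertex s j \<bullet> join_axis = 0" "join_axis \<bullet> base_vertex s j = 0"
proof -
  show "base_vertex s j \<bullet> join_axis = 0"
    by (simp add: base_vertex_def inner_axis inner_sum_left inner_diff_left)
  then show "join_axis \<bullet> base_vertex s j = 0" by (simp only: inner_commute)
qed

lemma inner_sum_basis:
  "j < d \<Longrightarrow> (\<Sum>i<d. basis s i) \<bullet> basis s' j = (if s = s' then 1 else 0)"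
  "j < d \<Longrightarrow> basis s j \<bullet> (\<Sum>i<d. basis s' i) = (if s = s' then 1 else 0)"
  "(\<Sum>i<d. basis s i) \<bullet> (\<Sum>i<d. basis s' i) = (if s = s' then real d else 0)"
proof -
  show *: "(\<Sum>i<d. basis s i) \<bullet> basis s' j = (if s = s' then 1 else 0)" if "j < d" for j
    using that by (auto simp: inner_sum_left inner_basis)
  show "basis s j \<bullet> (\<Sum>i<d. basis s' i) = (if s = s' then 1 else 0)" if "j < d"
    using that by (auto simp: inner_sum_right inner_basis)
  show "(\<Sum>i<d. basis s i) \<bullet> (\<Sum>i<d. basis s' i) = (if s = s' then real d else 0)"
    by (simp add: inner_sum_right[of _ _ "{..<d}"] *)
qed

lemma inner_dual_base:
  assumes "i \<le> d" "j \<le> d"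
  shows "dual_vec s i \<bullet> base_vertex s' j
       = (if s = s' then (if i = j then 1 else 0) - 1 / (real d + 1) else 0)"
proof -
  have "real d / (real d + 1) = 1 - 1 / (real d + 1)" by (simp add: field_simps)
  then show ?thesis
    using assms
    by (auto simp: dual_vec_def base_vertex_def inner_diff_right inner_basis inner_sum_basis)
qed

lemma inner_gradient_vertex:
  assumes "i \<le> d" "j \<le> d"
  shows "gradient (s, i) \<bullet> vertex (s', j) = offset (s, i) + (if (s, i) = (s', j) then 1 else 0)"
proof -
  have "gradient (s, i) \<bullet> vertex (s', j)
      = dual_vec s i \<bullet> base_vertex s' j + (if s' then (if s then 1 else -1) / (real d + 1) else 0)"
    using R by (auto simp: gradient_def vertex_def inner_add_left inner_add_right inner_axis_dual
        inner_axis_base inner_axis(2))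
  then show ?thesis using assms by (auto simp: inner_dual_base offset_def)
qed

sublocale barycentric_simplex "UNIV \<times> {..d}" vertex gradient offset
proof
  show "card ((UNIV :: bool set) \<times> {..d}) = Suc (DIM('a))"
    by (simp add: card_cartesian_product dim)
qed (auto simp: inner_gradient_vertex split: if_splits)

text \<open>
  The two summands come from the direction of the join, where centring at the centroids makes all the
  derivatives equal to \<open>1 / (d + 1)\<close> up to sign, and from the directions of the base simplices, where the scaling
  by \<open>R\<close> makes them small.
\<close>

lemma norm_gradient:
  "(norm (gradient (s, j)))\<^sup>2 \<le> 1 / (real d + 1)\<^sup>2 + real d / R\<^sup>2"
proof -
  have "(norm (gradient (s, j)))\<^sup>2 = (dual_vec s j \<bullet> dual_vec s j) / R\<^sup>2 + 1 / (real d + 1)\<^sup>2"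
    unfolding power2_norm_eq_inner
    by (cases s) (simp_all add: gradient_def inner_diff_left inner_diff_right inner_add_left
        inner_add_right inner_axis_dual inner_axis(2) power2_eq_square)
  moreover have "dual_vec s j \<bullet> dual_vec s j \<le> real d"
    using d by (simp add: dual_vec_def inner_basis inner_sum_basis)
  ultimately show ?thesis using R by (simp add: divide_right_mono)
qed

text \<open>
  Already \<open>A\<close> has two edge lengths: edges at its vertex with index \<open>d\<close> have length \<open>R\<close>, the others \<open>sqrt 2 * R\<close>; for
  both to occur it takes \<open>d \<ge> 2\<close>.
\<close>

lemma irregular_T: "irregular T"
proof -
  have "dist (vertex (False, 0)) (vertex (False, 1)) \<noteq> dist (vertex (False, 0)) (vertex (False, d))"
  proof -
    let ?u = "basis False 0" and ?v = "basis False 1"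
    have "vertex (False, 0) - vertex (False, 1) = R *\<^sub>R (?u - ?v)"
      using d by (simp add: vertex_def base_vertex_def algebra_simps)
    moreover have "vertex (False, 0) - vertex (False, d) = R *\<^sub>R ?u"
      using d by (simp add: vertex_def base_vertex_def algebra_simps)
    moreover have "(norm (?u - ?v))\<^sup>2 = 2" "(norm ?u)\<^sup>2 = 1"
      using d by (simp_all add: power2_norm_eq_inner inner_diff_left inner_diff_right inner_basis)
    ultimately show ?thesis using R by (auto simp: dist_norm)
  qed
  moreover have "closed_segment (vertex (False, 0)) (vertex (False, 1)) edge_of T"
    "closed_segment (vertex (False, 0)) (vertex (False, d)) edge_of T"
    using d by (auto intro!: edge_T)
  ultimately show ?thesis unfolding irregular_def by blast
qed

lemma normal_frame_b: "normal_frame (2 * d) join_axis b"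
  using b by (auto simp: normal_frame_def dim orthonormal_frame_def norm_eq_1 join_axis_def)

section \<open>The middle section and the facets\<close>

definition "middle_section = {x. join_axis \<bullet> x = 1 / 2} \<inter> T"

lemma midpoint_interior_T: "(1 / 2) *\<^sub>R join_axis \<in> interior T"
proof (rule interior_T)
  have "1 / (real d + 1) > 0" by simp
  moreover fix i assume "i \<in> (UNIV :: bool set) \<times> {..d}"
  ultimately show "offset i < gradient i \<bullet> ((1 / 2) *\<^sub>R join_axis)"
    by (cases i) (auto simp: gradient_def offset_def inner_diff_left inner_add_left inner_axis_dual
        inner_axis(2) divide_simps)
qed

text \<open>
  The facet inequalities of \<open>T\<close> separate into those that involve only the \<open>A\<close>-directions and those that
  involve only the \<open>B\<close>-directions. At height \<open>t\<close> their constant terms are proportional to \<open>1 - t\<close> and \<open>t\<close>, so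
  the slice is the middle one scaled by \<open>2 (1 - t)\<close> and \<open>2 t\<close> in the respective directions.
\<close>

lemma measure_T_section:
  "measure lborel T = 4 ^ d * (fact d)\<^sup>2 / fact (2 * d + 1) * vol (2 * d) middle_section"
proof -
  let ?c = "\<lambda>t i. if i < d then 2 * (1 - t) else 2 * t :: real"
  let ?I = "4 ^ d * (fact d)\<^sup>2 / fact (2 * d + 1) :: real"
  define p where "p = (1 / 2) *\<^sub>R join_axis"
  have p: "join_axis \<bullet> p = 1 / 2" by (simp add: p_def inner_axis)
  have clS: "closed middle_section"
    unfolding middle_section_def using compact_T by (intro closed_Int closed_hyperplane compact_imp_closed)
  have int: "p \<in> interior T" unfolding p_def by (rule midpoint_interior_T)
  have aff: "affine hull middle_section = {x. join_axis \<bullet> x = 1 / 2}"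
    unfolding middle_section_def
  proof -
    have "{x. join_axis \<bullet> x = 1 / 2} \<inter> interior T \<noteq> {}" using int p by blast
    from affine_hull_affine_Int_nonempty_interior[OF affine_hyperplane this]
    show "affine hull ({x. join_axis \<bullet> x = 1 / 2} \<inter> T) = {x. join_axis \<bullet> x = 1 / 2}"
      by (simp only: affine_hull_eq[THEN iffD2, OF affine_hyperplane])
  qed
  have volS: "vol (2 * d) middle_section = enn2real (chart_volume (2 * d) p b middle_section)"
    by (rule vol_eq_chart_volume[OF normal_frame_b clS aff p])
  \<comment> \<open>The value of \<open>dual_vec s j\<close> in frame coordinates.\<close>
  define M where "M s j x = (if j < d then x (if s then d + j else j)
      else - (\<Sum>i<d. x (if s then d + i else i)))" for s j and x :: "nat \<Rightarrow> real"
  have dual_frame: "dual_vec s j \<bullet> frame_map (2 * d) (t *\<^sub>R join_axis) b x = M s j x" for s j t x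
  proof -
    have "basis s i \<bullet> frame_map (2 * d) (t *\<^sub>R join_axis) b x = x (if s then d + i else i)" if "i < d" for i
      using that inner_frame_map[of "2 * d" b "if s then d + i else i" "t *\<^sub>R join_axis" x] normal_frame_b
      by (auto simp: basis_def normal_frame_def inner_commute[of _ "frame_map _ _ _ _"])
    then show ?thesis by (simp add: dual_vec_def M_def inner_sum_left)
  qed
  have axis_frame: "join_axis \<bullet> frame_map (2 * d) (t *\<^sub>R join_axis) b x = t" for t x
    by (simp add: inner_normal_frame_map[OF normal_frame_b] inner_axis)
  have mem: "frame_map (2 * d) (t *\<^sub>R join_axis) b x \<in> T \<longleftrightarrow>
      (\<forall>s. \<forall>j\<le>d. 0 \<le> M s j x / R + (if s then t else 1 - t) / (real d + 1))" for t x
  proof -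
    have "gradient (s, j) \<bullet> frame_map (2 * d) (t *\<^sub>R join_axis) b x
        = offset (s, j) + (M s j x / R + (if s then t else 1 - t) / (real d + 1))" for s j
      by (simp add: gradient_def offset_def inner_add_left inner_diff_left dual_frame axis_frame
          diff_divide_distrib)
    then show ?thesis by (auto simp: mem_T)
  qed
  have M_scale: "M s j (\<lambda>i. ?c t i * x i) = (if s then 2 * t else 2 * (1 - t)) * M s j x"
    if "j \<le> d" for s j t x
    using that by (auto simp: M_def sum_distrib_left)
  have "emeasure lborel T = ennreal ?I * chart_volume (2 * d) p b middle_section"
  proof (rule emeasure_scaled_slices[OF normal_frame_b, where q = 0 and h = 1 and c = ?c])
    show "T \<in> sets borel" using compact_T by (simp add: compact_imp_closed borel_closed)
    have "T \<subseteq> {x. join_axis \<bullet> x \<ge> 0} \<inter> {x. join_axis \<bullet> x \<le> 1}"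
      unfolding T_def
      by (rule hull_minimal)
        (auto intro!: convex_Int convex_halfspace_ge convex_halfspace_le
          simp: vertex_def inner_add_right inner_axis inner_axis_base)
    then show "join_axis \<bullet> 0 \<le> join_axis \<bullet> x \<and> join_axis \<bullet> x \<le> join_axis \<bullet> 0 + 1" if "x \<in> T" for x
      using that by auto
    show "frame_map (2 * d) (0 + t *\<^sub>R join_axis) b (\<lambda>i. ?c t i * x i) \<in> T
        \<longleftrightarrow> frame_map (2 * d) p b x \<in> middle_section" if t: "0 < t" "t < 1" for t x
    proof -
      have "0 \<le> M s j (\<lambda>i. ?c t i * x i) / R + (if s then t else 1 - t) / (real d + 1)
         \<longleftrightarrow> 0 \<le> M s j x / R + (if s then 1 / 2 else 1 - 1 / 2) / (real d + 1)" (is "0 \<le> ?l \<longleftrightarrow> 0 \<le> ?r")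
        if "j \<le> d" for s j
      proof -
        have "?l = (if s then 2 * t else 2 * (1 - t)) * ?r"
          unfolding M_scale[OF that] by (simp add: field_simps)
        then show ?thesis using t by (simp add: zero_le_mult_iff)
      qed
      then have "frame_map (2 * d) (t *\<^sub>R join_axis) b (\<lambda>i. ?c t i * x i) \<in> T
         \<longleftrightarrow> frame_map (2 * d) p b x \<in> T"
        unfolding p_def mem by blast
      then show ?thesis using axis_frame[of "1 / 2"] by (simp add: middle_section_def p_def)
    qed
    show "(2 * (1 - t)) ^ d * (2 * t) ^ d = (\<Prod>i<2 * d. ?c t i)" for t :: real
    proof -
      have "{..<2 * d} = {..<d} \<union> {d..<2 * d}" by auto
      then have "(\<Prod>i<2 * d. ?c t i) = (\<Prod>i<d. ?c t i) * (\<Prod>i\<in>{d..<2 * d}. ?c t i)"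
        by (simp add: prod.union_disjoint ivl_disj_int)
      then show ?thesis by simp
    qed
    show "((\<lambda>t. (2 * (1 - t)) ^ d * (2 * t) ^ d) has_integral ?I) {0..1}"
      using d by (intro has_integral_Beta_nat) auto
  qed auto
  then show ?thesis unfolding measure_def volS by (simp add: enn2real_mult)
qed

lemma measure_T_pos: "measure lborel T > 0"
proof -
  obtain r where r: "r > 0" "ball ((1 / 2) *\<^sub>R join_axis) r \<subseteq> T"
    using midpoint_interior_T unfolding mem_interior by blast
  have "0 < measure lborel (ball ((1 / 2) *\<^sub>R join_axis) r)" using r(1) by (rule content_ball_pos)
  also have "\<dots> \<le> measure lborel T"
    using r(2) compact_T by (intro measure_mono_fmeasurable fmeasurable_compact) auto
  finally show ?thesis .
qed

lemma facet_less_section: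
  assumes small: "1 / (real d + 1)\<^sup>2 + real d / R\<^sup>2 < (fact (2 * d) / (4 ^ d * (fact d)\<^sup>2))\<^sup>2"
    and G: "G facet_of T"
  shows "vol (2 * d) G < vol (2 * d) middle_section"
proof -
  let ?Q = "fact (2 * d) / (4 ^ d * (fact d)\<^sup>2) :: real"
  obtain s j where sj: "(s, j) \<in> UNIV \<times> {..d}" "G = convex hull (vertex ` (UNIV \<times> {..d} - {(s, j)}))"
    using facet_T[OF G] by (metis surj_pair)
  have "(norm (gradient (s, j)))\<^sup>2 < ?Q\<^sup>2" using norm_gradient small by (rule le_less_trans)
  then have lt: "norm (gradient (s, j)) < ?Q" by (rule power2_less_imp_less) simp
  have "vol (2 * d) G = measure lborel T * (norm (gradient (s, j)) * real (2 * d + 1))"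
    using measure_T_facet[OF sj(1), of "2 * d"] by (simp add: dim sj(2))
  also have "\<dots> < measure lborel T * (?Q * real (2 * d + 1))"
    using lt measure_T_pos by (intro mult_strict_left_mono mult_strict_right_mono) auto
  also have "\<dots> = vol (2 * d) middle_section"
  proof -
    define A where "A = (4 ^ d * (fact d)\<^sup>2 :: real)"
    define N where "N = real (2 * d + 1)"
    have "A > 0" "N > 0" by (simp_all add: A_def N_def)
    then have "A / (N * fact (2 * d)) * v * (fact (2 * d) / A * N) = v" for v by simp
    moreover have "fact (2 * d + 1) = N * fact (2 * d)" by (simp add: N_def)
    ultimately show ?thesis unfolding measure_T_section by (simp only: A_def N_def)
  qed
  finally show ?thesis .
qed

end

theorem theorem5:
  fixes n :: nat
  assumes "DIM('a::euclidean_space) = n" and "odd n" and "n \<ge> 5"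
  shows "\<exists>T H :: 'a set.
    int n simplex T \<and> irregular T \<and>
    (\<exists>a b. a \<noteq> 0 \<and> H = {x. a \<bullet> x = b}) \<and>
    (\<forall>G. G facet_of T \<longrightarrow> vol (n - 1) (H \<inter> T) > vol (n - 1) G)"
proof -
  obtain d where n: "n = 2 * d + 1" using \<open>odd n\<close> by (elim oddE)
  then have d: "d \<ge> 2" using \<open>n \<ge> 5\<close> by simp
  obtain b where b: "bij_betw b {..<n} (Basis :: 'a set)"
    using ex_bij_betw_nat_finite[of "Basis :: 'a set"] assms(1) by (auto simp: atLeast0LessThan)
  have ob: "orthonormal_frame n b"
    using orthonormal_frame_Basis[OF b] .
  define q :: real where "q = fact (2 * d) / (4 ^ d * (fact d)\<^sup>2)"
  define \<epsilon> where "\<epsilon> = q\<^sup>2 - 1 / (real d + 1)\<^sup>2"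
  have "1 / (real d + 1) < q"
    using central_binomial_factorials[OF d] by (simp add: q_def field_simps)
  then have "(1 / (real d + 1))\<^sup>2 < q\<^sup>2" by (intro power_strict_mono) auto
  then have \<epsilon>: "\<epsilon> > 0" by (simp add: \<epsilon>_def power_divide)
  \<comment> \<open>Large enough for \<open>d / R < \<epsilon>\<close>, and at least 1 so that \<open>d / R\<^sup>2 \<le> d / R\<close>.\<close>
  define R where "R = real d / \<epsilon> + 1"
  have R: "R \<ge> 1" using \<epsilon> by (simp add: R_def)
  then have "R * 1 \<le> R\<^sup>2" unfolding power2_eq_square by (intro mult_left_mono) auto
  then have "real d / R\<^sup>2 \<le> real d / R" using R by (intro divide_left_mono) auto
  also have "\<dots> < \<epsilon>" using R \<epsilon> by (simp add: R_def field_simps)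
  finally have small: "1 / (real d + 1)\<^sup>2 + real d / R\<^sup>2 < q\<^sup>2" by (simp add: \<epsilon>_def)
  interpret S: two_orthogonal_simplices d b R
    by standard (use d assms(1) n ob R in auto)
  have "S.join_axis \<noteq> 0" using S.inner_axis(2) by force
  moreover have "int n simplex S.T" using S.simplex_T assms(1) by simp
  moreover have "\<forall>G. G facet_of S.T \<longrightarrow> vol (n - 1) ({x. S.join_axis \<bullet> x = 1 / 2} \<inter> S.T) > vol (n - 1) G"
    using S.facet_less_section small by (simp add: n q_def S.middle_section_def)
  ultimately show ?thesis using S.irregular_T by blast
qed

end
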